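(* For every connected weighted graph $(\Gamma,w)$ with first Betti number $b$, $$\mu_w(\mathcal{B}_{st}(\Gamma,w))\cdot \mathrm{Vol}(\Gamma,w)^{b/2}\ge \omega_b,$$ where $\omega_b$ is the volume of the Euclidean unit ball of $\mathbb{R}^b$.
   Context: A graph is a finite non-oriented multigraph $\Gamma=(V,E)$ (multiple edges and loops allowed). A weighted graph $(\Gamma,w)$ is a graph with a weight function $w:E\to\mathbb{R}^+$ (positive values). The length of a cycle is the sum of the weights of its edges (with multiplicity), and $\mathrm{Vol}(\Gamma,w)=\sum_{e\in E}w(e)$. After choosing an orientation of each edge, the space of real $1$-chains is $C(\Gamma,\mathbb{R})=\bigoplus_{e\in E}\mathbb{R}e$, the real homology $H_1(\Gamma,\mathbb{R})$ is identified with the subspace of cycles (of dimension $b$), and $H_1(\Gamma,\mathbb{Z})$ with a lattice in $H_1(\Gamma,\mathbb{R})$. Enumerate the edges $e_1,\ldots,e_{|E|}$ and put $w_i=w(e_i)$; the scalar product on $C(\Gamma,\mathbb{R})$ is defined by $\langle e_i,e_j\rangle_w=w_i\delta_{ij}$, and $\mu_w$ is the Haar (Lebesgue) measure on $H_1(\Gamma,\mathbb{R})$ induced by the restriction of $\langle\cdot,\cdot\rangle_w$. Stable norm: fix $x_0\in V$; for $\alpha\in\pi_1(\Gamma,x_0)$ let $|\alpha|_w$ be the minimal length of a cycle based at $x_0$ representing $\alpha$, and for $h\in H_1(\Gamma,\mathbb{Z})$ let $|h|_w$ be the minimum of $|\alpha|_w$ over the $\alpha\in\pi_1(\Gamma,x_0)$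 with homology class $h$. For $u\in H_1(\Gamma,\mathbb{R})$, $$|u|_{st}=\lim_{n\to+\infty}\frac1n|\overline{nu}|_w,$$ where $\overline{nu}$ is a point of $H_1(\Gamma,\mathbb{Z})$ closest to $nu$ for an arbitrary fixed Euclidean metric; the limit exists and is independent of $x_0$. The unit ball is $\mathcal{B}_{st}(\Gamma,w)=\{u\in H_1(\Gamma,\mathbb{R})\mid |u|_{st}\le 1\}$. *)

theory Defs
  imports
    "HOL-Analysis.Analysis"
    "Graph_Theory.Digraph_Component"
    "Graph_Theory.Arc_Walk"
begin

text \<open>
  A finite non-oriented multigraph together with a chosen orientation of each edge is a
  \<^locale>\<open>fin_digraph\<close>: an arc is an edge, directed from its tail to its head. Loops, parallel
  edges and the absence of edges are all allowed. Edges are drawn from a finite type so that the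
  space of real 1-chains is the subspace of \<^typ>\<open>real^'e\<close> of vectors supported on
  the edges of the graph.
\<close>

type_synonym 'e chain = "real ^ 'e"

definition boundary :: "('v, 'e::finite) pre_digraph \<Rightarrow> 'e chain \<Rightarrow> 'v \<Rightarrow> real" where
  "boundary G c v = (\<Sum>e\<in>in_arcs G v. c $ e) - (\<Sum>e\<in>out_arcs G v. c $ e)"

definition H1 :: "('v, 'e::finite) pre_digraph \<Rightarrow> 'e chain set" where
  "H1 G = {c. (\<forall>e. e \<notin> arcs G \<longrightarrow> c $ e = 0) \<and> (\<forall>v\<in>verts G. boundary G c v = 0)}"

definition H1_int :: "('v, 'e::finite) pre_digraph \<Rightarrow> 'e chain set" where
  "H1_int G = {c \<in> H1 G. \<forall>e. c $ e \<in> \<int>}"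

definition betti :: "('v, 'e::finite) pre_digraph \<Rightarrow> nat" where
  "betti G = dim (H1 G)"

text \<open>
  The power \<open>Vol\<^sup>b\<^sup>/\<^sup>2\<close> of the total weight is to be written \<open>sqrt Vol ^ b\<close>: with \<open>0 powr 0 = 0\<close>
  the version with \<^const>\<open>powr\<close> would be wrong for the graph with one vertex and no edges.
\<close>

definition Vol :: "('v, 'e) pre_digraph \<Rightarrow> ('e \<Rightarrow> real) \<Rightarrow> real" where
  "Vol G w = (\<Sum>e\<in>arcs G. w e)"

definition chain_inner ::
  "('v, 'e::finite) pre_digraph \<Rightarrow> ('e \<Rightarrow> real) \<Rightarrow> 'e chain \<Rightarrow> 'e chain \<Rightarrow> real" where
  "chain_inner G w c d = (\<Sum>e\<in>arcs G. w e * c $ e * d $ e)"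


text \<open>
  The Haar measure on the real homology, as Lebesgue measure in the coordinates of an orthonormal
  basis; it does not depend on the basis, so an arbitrary one is taken.
\<close>

definition orthonormal_basis_H1 ::
  "('v, 'e::finite) pre_digraph \<Rightarrow> ('e \<Rightarrow> real) \<Rightarrow> (nat \<Rightarrow> 'e chain) \<Rightarrow> bool" where
  "orthonormal_basis_H1 G w B \<longleftrightarrow>
     span (B ` {..<betti G}) = H1 G \<and>
     (\<forall>i<betti G. \<forall>j<betti G. chain_inner G w (B i) (B j) = (if i = j then 1 else 0))"

definition haar_H1 :: "('v, 'e::finite) pre_digraph \<Rightarrow> ('e \<Rightarrow> real) \<Rightarrow> 'e chain measure" where
  "haar_H1 G w =
     (let B = (SOME B. orthonormal_basis_H1 G w B) in
      distr (\<Pi>\<^sub>M i\<in>{..<betti G}. lborel) (restrict_space borel (H1 G))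
        (\<lambda>x. \<Sum>i<betti G. x i *\<^sub>R B i))"


text \<open>
  Edge paths traverse edges in either direction: they are the walks of the digraph in which each
  edge \<open>e\<close> gives \<open>(e, True)\<close>, along the orientation, and \<open>(e, False)\<close>, against it.
\<close>

definition bidir :: "('v, 'e) pre_digraph \<Rightarrow> ('v, 'e \<times> bool) pre_digraph" where
  "bidir G = \<lparr> verts = verts G, arcs = arcs G \<times> UNIV,
     tail = (\<lambda>(e, s). if s then tail G e else head G e),
     head = (\<lambda>(e, s). if s then head G e else tail G e) \<rparr>"

definition based_cycles :: "('v, 'e) pre_digraph \<Rightarrow> 'v \<Rightarrow> ('e \<times> bool) list set" where
  "based_cycles G x = {p. pre_digraph.awalk (bidir G) x p x}"

definition path_length :: "('e \<Rightarrow> real) \<Rightarrow> ('e \<times> bool) list \<Rightarrow> real" where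
  "path_length w p = (\<Sum>(e, s)\<leftarrow>p. w e)"

definition path_chain :: "('e::finite \<times> bool) list \<Rightarrow> 'e chain" where
  "path_chain p = (\<Sum>(e, s)\<leftarrow>p. if s then axis e 1 else - axis e 1)"


text \<open>
  Two based edge cycles are homotopic iff they are connected by finitely many insertions and
  deletions of backtrackings, an edge followed immediately by its reverse.
\<close>

definition backtracking ::
  "('v, 'e) pre_digraph \<Rightarrow> 'v \<Rightarrow> (('e \<times> bool) list \<times> ('e \<times> bool) list) set" where
  "backtracking G x = {(p, q). p \<in> based_cycles G x \<and> q \<in> based_cycles G x \<and>
     (\<exists>r e s t. p = r @ t \<and> q = r @ [(e, s), (e, \<not> s)] @ t)}"

definition homotopy ::
  "('v, 'e) pre_digraph \<Rightarrow> 'v \<Rightarrow> (('e \<times> bool) list \<times> ('e \<times> bool) list) set" where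
  "homotopy G x = (backtracking G x \<union> (backtracking G x)\<inverse>)\<^sup>* \<inter>
     based_cycles G x \<times> based_cycles G x"

definition pi1 :: "('v, 'e) pre_digraph \<Rightarrow> 'v \<Rightarrow> ('e \<times> bool) list set set" where
  "pi1 G x = based_cycles G x // homotopy G x"

text \<open>Homotopic cycles have the same chain, so the image below is a singleton.\<close>

definition homology_class :: "('e::finite \<times> bool) list set \<Rightarrow> 'e chain" where
  "homology_class \<alpha> = the_elem (path_chain ` \<alpha>)"

text \<open>
  Both infima are minima: a finite graph with positive weights has only finitely many edge paths
  of length below any given bound.
\<close>

definition pi1_length :: "('e \<Rightarrow> real) \<Rightarrow> ('e \<times> bool) list set \<Rightarrow> real" where
  "pi1_length w \<alpha> = (INF p\<in>\<alpha>. path_length w p)"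

definition homology_length ::
  "('v, 'e::finite) pre_digraph \<Rightarrow> ('e \<Rightarrow> real) \<Rightarrow> 'v \<Rightarrow> 'e chain \<Rightarrow> real" where
  "homology_length G w x h = (INF \<alpha>\<in>{\<alpha> \<in> pi1 G x. homology_class \<alpha> = h}. pi1_length w \<alpha>)"


text \<open>
  The auxiliary Euclidean metric on the real homology comes from an arbitrary scalar product
  \<open>g\<close>, unrelated to \<^const>\<open>chain_inner\<close>. It is only relevant on the subspace.
\<close>

definition scalar_product_on :: "'a::real_vector set \<Rightarrow> ('a \<Rightarrow> 'a \<Rightarrow> real) \<Rightarrow> bool" where
  "scalar_product_on S g \<longleftrightarrow>
     (\<forall>x\<in>S. \<forall>y\<in>S. g x y = g y x) \<and>
     (\<forall>x\<in>S. \<forall>y\<in>S. \<forall>z\<in>S. g (x + y) z = g x z + g y z) \<and>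
     (\<forall>a. \<forall>x\<in>S. \<forall>y\<in>S. g (a *\<^sub>R x) y = a * g x y) \<and>
     (\<forall>x\<in>S. x \<noteq> 0 \<longrightarrow> g x x > 0)"

definition nearest_H1_int ::
  "('v, 'e::finite) pre_digraph \<Rightarrow> ('e chain \<Rightarrow> 'e chain \<Rightarrow> real) \<Rightarrow> 'e chain \<Rightarrow> 'e chain" where
  "nearest_H1_int G g v = arg_min_on (\<lambda>z. sqrt (g (z - v) (z - v))) (H1_int G)"

definition stable_norm ::
  "('v, 'e::finite) pre_digraph \<Rightarrow> ('e \<Rightarrow> real) \<Rightarrow> 'v \<Rightarrow> ('e chain \<Rightarrow> 'e chain \<Rightarrow> real) \<Rightarrow>
   'e chain \<Rightarrow> real" where
  "stable_norm G w x g u =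
     lim (\<lambda>n. 1 / real n * homology_length G w x (nearest_H1_int G g (real n *\<^sub>R u)))"

definition stable_ball ::
  "('v, 'e::finite) pre_digraph \<Rightarrow> ('e \<Rightarrow> real) \<Rightarrow> 'v \<Rightarrow> ('e chain \<Rightarrow> 'e chain \<Rightarrow> real) \<Rightarrow>
   'e chain set" where
  "stable_ball G w x g = {u \<in> H1 G. stable_norm G w x g u \<le> 1}"

end

theory Submission
  imports Defs
begin

text \<open>
  The stable norm is the weighted \<open>l\<^sup>1\<close> norm of real cycles. Indeed a loop with homology class \<open>h\<close>
  is at least as long as \<open>h\<close>; conversely, an integral cycle is a sum of closed trails traversed in
  the direction of its flow, so that no cancellation occurs, and these trails can be inserted into
  a fixed null-homologous loop visiting every vertex. Hence the length of a class exceeds its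
  \<open>l\<^sup>1\<close> norm by a bounded amount, which disappears in the limit. The same trails show that
  the integral cycles span \<open>H\<^sub>1\<close>, hence that nearest lattice points stay at bounded distance from
  the multiples of a given cycle. By Cauchy-Schwarz the \<open>l\<^sup>1\<close> norm is at most
  \<open>sqrt Vol\<close> times the Euclidean norm, so the unit ball contains the Euclidean ball of radius
  \<open>1 / sqrt Vol\<close>.
\<close>

section \<open>Closed trails along the flow of a real cycle\<close>

text \<open>The orbit of \<open>a0\<close> stays in a finite set, so it repeats and contains a
  periodic point. Taking the least positive period \<open>k\<close> makes the points of one round
  distinct: a coincidence at i < j < k, pushed forward by k - j further steps, would be an earlier
  return.\<close>

lemma ex_distinct_funpow_cycle:
  assumes "finite A" "a0 \<in> A" "\<And>a. a \<in> A \<Longrightarrow> f a \<in> A"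
  obtains a k where "a \<in> A" "k > 0" "(f ^^ k) a = a" "distinct (map (\<lambda>i. (f ^^ i) a) [0..<k])"
proof -
  have in_A: "(f ^^ n) a \<in> A" if "a \<in> A" for n a
    using that assms(3) by (induction n) auto
  have "\<not> inj (\<lambda>n. (f ^^ n) a0)"
  proof
    assume "inj (\<lambda>n. (f ^^ n) a0)"
    moreover have "finite (range (\<lambda>n. (f ^^ n) a0))"
      using in_A[OF assms(2)] by (intro finite_subset[OF _ assms(1)]) auto
    ultimately show False
      using finite_imageD infinite_UNIV_nat by blast
  qed
  then obtain i j where ij: "i < j" "(f ^^ i) a0 = (f ^^ j) a0"
    unfolding inj_def by (metis linorder_neqE_nat)
  define a where "a = (f ^^ i) a0"
  have a: "a \<in> A" using in_A[OF assms(2)] by (simp add: a_def)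
  have "(f ^^ (j - i)) a = a"
    using ij funpow_add[of "j - i" i f] by (simp add: a_def)
  then have ex: "\<exists>k>0. (f ^^ k) a = a" using ij(1) by (intro exI[of _ "j - i"]) auto
  define k where "k = (LEAST k. k > 0 \<and> (f ^^ k) a = a)"
  have k: "k > 0" "(f ^^ k) a = a" using LeastI_ex[OF ex] by (auto simp: k_def)
  have least: "\<not> (0 < m \<and> (f ^^ m) a = a)" if "m < k" for m
    using not_less_Least that unfolding k_def by blast
  have neq: "(f ^^ i) a \<noteq> (f ^^ j) a" if "i < j" "j < k" for i j
  proof
    assume eq: "(f ^^ i) a = (f ^^ j) a"
    have "(f ^^ (k - j + i)) a = (f ^^ (k - j)) ((f ^^ i) a)"
      by (simp add: funpow_add)
    also have "\<dots> = (f ^^ (k - j + j)) a"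
      unfolding funpow_add o_apply eq ..
    also have "\<dots> = a" using k that by simp
    finally moreover have "k - j + i < k" "0 < k - j + i" using that by arith+
    ultimately show False using least by blast
  qed
  have "distinct (map (\<lambda>i. (f ^^ i) a) [0..<k])"
    unfolding distinct_map by (auto simp: inj_on_def) (metis neq linorder_neqE_nat)
  with a k that show thesis by blast
qed

section \<open>Chains and lengths of edge paths, and the lattice of integral cycles\<close>

lemma path_chain_simps [simp]:
  "path_chain [] = 0"
  "path_chain ((e, s) # p) = (if s then axis e 1 else - axis e 1) + path_chain p"
  "path_chain (p @ q) = path_chain p + path_chain q"
  by (simp_all add: path_chain_def)

lemma path_length_simps [simp]:
  "path_length w [] = 0"
  "path_length w ((e, s) # p) = w e + path_length w p"
  "path_length w (p @ q) = path_length w p + path_length w q"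
  by (simp_all add: path_length_def)

lemma path_chain_Ints: "path_chain p $ e \<in> \<int>"
  by (induction p) (auto simp: axis_def)

lemma bidir_simps [simp]:
  "verts (bidir G) = verts G"
  "arcs (bidir G) = arcs G \<times> UNIV"
  "tail (bidir G) (e, s) = (if s then tail G e else head G e)"
  "head (bidir G) (e, s) = (if s then head G e else tail G e)"
  by (simp_all add: bidir_def)

lemma boundary_add: "boundary G (c + d) v = boundary G c v + boundary G d v"
  by (simp add: boundary_def sum.distrib)

lemma boundary_scaleR: "boundary G (a *\<^sub>R c) v = a * boundary G c v"
  by (simp add: boundary_def sum_distrib_left right_diff_distrib)

lemma subspace_H1: "subspace (H1 G)"
  by (auto simp: subspace_def H1_def boundary_add boundary_scaleR) (simp add: boundary_def)

lemma H1_int_subset: "H1_int G \<subseteq> H1 G"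
  by (auto simp: H1_int_def)

lemma zero_H1_int: "0 \<in> H1_int G"
  by (simp add: H1_int_def subspace_0[OF subspace_H1])

lemma H1_int_add: "a \<in> H1_int G \<Longrightarrow> b \<in> H1_int G \<Longrightarrow> a + b \<in> H1_int G"
  by (simp add: H1_int_def subspace_add[OF subspace_H1])

lemma H1_int_diff: "a \<in> H1_int G \<Longrightarrow> b \<in> H1_int G \<Longrightarrow> a - b \<in> H1_int G"
  by (simp add: H1_int_def subspace_diff[OF subspace_H1])

lemma H1_int_scale: "a \<in> H1_int G \<Longrightarrow> of_int k *\<^sub>R a \<in> H1_int G"
  by (simp add: H1_int_def subspace_scale[OF subspace_H1])

lemma H1_int_sum: "(\<And>i. i \<in> I \<Longrightarrow> f i \<in> H1_int G) \<Longrightarrow> sum f I \<in> H1_int G"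
  by (induction I rule: infinite_finite_induct) (auto simp: zero_H1_int H1_int_add)

locale weighted_digraph = fin_digraph G for G :: "('v, 'e::finite) pre_digraph" +
  fixes w :: "'e \<Rightarrow> real"
  assumes weight_pos: "e \<in> arcs G \<Longrightarrow> w e > 0"

sublocale weighted_digraph \<subseteq> bidir: wf_digraph "bidir G"
  by unfold_locales (auto split: if_splits)

context weighted_digraph
begin

text \<open>On \<open>H1 G\<close> this turns out to be the stable norm. Only edges of the graph are
  summed, as \<open>w\<close> is unconstrained elsewhere.\<close>

definition l1 :: "'e chain \<Rightarrow> real" where
  "l1 c = (\<Sum>e\<in>arcs G. w e * \<bar>c $ e\<bar>)"

lemma l1_add_le: "l1 (c + d) \<le> l1 c + l1 d"
  unfolding l1_def sum.distrib[symmetric] distrib_left[symmetric]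
  by (intro sum_mono mult_left_mono) (auto intro: less_imp_le[OF weight_pos])

lemma l1_scaleR: "l1 (a *\<^sub>R c) = \<bar>a\<bar> * l1 c"
  by (simp add: l1_def sum_distrib_left abs_mult algebra_simps)

lemma l1_minus: "l1 (- c) = l1 c"
  by (simp add: l1_def)

lemma l1_diff_le: "\<bar>l1 c - l1 d\<bar> \<le> l1 (c - d)"
  using l1_add_le[of "c - d" d] l1_add_le[of "d - c" c] l1_minus[of "d - c"] by simp

lemma l1_le_norm: "l1 c \<le> Vol G w * norm c"
  unfolding l1_def Vol_def sum_distrib_right
  by (intro sum_mono mult_left_mono) (auto intro: less_imp_le[OF weight_pos] component_le_norm_cart)

lemma l1_axis: "e \<in> arcs G \<Longrightarrow> l1 (axis e 1) = w e"
  by (simp add: l1_def axis_def if_distrib cong: if_cong)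

text \<open>Subadditivity, one edge at a time. The inequality may be strict: opposite traversals of
  an edge cancel in the chain but both count in the length.\<close>

lemma l1_path_chain_le:
  "bidir.awalk u p v \<Longrightarrow> l1 (path_chain p) \<le> path_length w p"
proof (induction p arbitrary: u)
  case Nil
  then show ?case by (simp add: l1_def)
next
  case (Cons a p)
  obtain e s where a: "a = (e, s)" by fastforce
  have "e \<in> arcs G" and p: "l1 (path_chain p) \<le> path_length w p"
    using Cons by (auto simp: a bidir.awalk_Cons_iff)
  then have "l1 (if s then axis e 1 else - axis e 1) = w e"
    by (simp add: l1_minus l1_axis)
  then show ?case
    using l1_add_le[of "if s then axis e 1 else - axis e 1" "path_chain p"] p
    by (simp add: a)
qed

lemma path_length_nonneg: "bidir.awalk u p v \<Longrightarrow> 0 \<le> path_length w p"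
  by (rule order_trans[OF _ l1_path_chain_le])
    (auto simp: l1_def intro!: sum_nonneg mult_nonneg_nonneg less_imp_le[OF weight_pos])

lemma boundary_axis:
  assumes "e \<in> arcs G"
  shows "boundary G (axis e 1) y = of_bool (head G e = y) - of_bool (tail G e = y)"
proof -
  have "finite (in_arcs G y)" "finite (out_arcs G y)"
    by (auto intro: finite_subset[OF _ finite_arcs] simp: in_arcs_def out_arcs_def)
  then show ?thesis
    using assms by (simp add: boundary_def axis_def in_arcs_def out_arcs_def if_distrib cong: if_cong)
qed

text \<open>Telescoping: every step contributes its end minus its start, in either direction of
  traversal. Closed walks therefore give integral cycles.\<close>

lemma boundary_path_chain:
  "bidir.awalk u p v \<Longrightarrow> boundary G (path_chain p) y = of_bool (v = y) - of_bool (u = y)"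
proof (induction p arbitrary: u)
  case Nil
  then show ?case by (auto simp: bidir.awalk_Nil_iff boundary_def)
next
  case (Cons a p)
  obtain e s where a: "a = (e, s)" by fastforce
  have "e \<in> arcs G" using Cons by (auto simp: a bidir.awalk_Cons_iff)
  then show ?case
    using Cons boundary_scaleR[of G "-1" "axis e 1"]
    by (auto simp: a bidir.awalk_Cons_iff boundary_add boundary_axis)
qed

lemma path_chain_H1_int:
  assumes "bidir.awalk u p u"
  shows "path_chain p \<in> H1_int G"
proof -
  have "path_chain p $ e = 0" if "set p \<subseteq> arcs G \<times> UNIV" "e \<notin> arcs G" for e
    using that by (induction p) (auto simp: axis_def)
  then show ?thesis
    using assms boundary_path_chain[OF assms]
    by (auto simp: H1_int_def H1_def path_chain_Ints bidir.awalk_def)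
qed

text \<open>The pair \<open>(e, s)\<close> is an edge traversed along the flow of \<open>h\<close>,
  ending at \<open>y\<close>, say. If no edge could be left from \<open>y\<close> along the flow,
  all coefficients into \<open>y\<close> would be nonnegative and all those out of it nonpositive,
  with a strict contribution from \<open>e\<close>; the boundary at \<open>y\<close> would be
  positive.\<close>

lemma successor_arc:
  assumes "h \<in> H1 G" "e \<in> arcs G" "if s then h $ e > 0 else h $ e < 0"
  shows "\<exists>e' s'. e' \<in> arcs G \<and> (if s' then h $ e' > 0 else h $ e' < 0) \<and>
           tail (bidir G) (e', s') = head (bidir G) (e, s)"
proof (rule ccontr)
  assume no: "\<not> ?thesis"
  define y where "y = head (bidir G) (e, s)"
  have no': "tail (bidir G) (e', s') \<noteq> y"
    if "e' \<in> arcs G" "if s' then h $ e' > 0 else h $ e' < 0" for e' s'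
    using no that unfolding y_def by blast
  have fin: "finite (in_arcs G y)" "finite (out_arcs G y)"
    by (auto intro: finite_subset[OF _ finite_arcs] simp: in_arcs_def out_arcs_def)
  have y: "y \<in> verts G" using assms(2) by (auto simp: y_def)
  have i: "h $ a \<ge> 0" if "a \<in> in_arcs G y" for a
  proof (rule ccontr)
    assume "\<not> h $ a \<ge> 0"
    then show False using no'[of a False] that by (auto simp: in_arcs_def)
  qed
  have o: "h $ a \<le> 0" if "a \<in> out_arcs G y" for a
  proof (rule ccontr)
    assume "\<not> h $ a \<le> 0"
    then show False using no'[of a True] that by (auto simp: out_arcs_def)
  qed
  have "boundary G h y > 0"
  proof (cases s)
    case True
    have "0 < (\<Sum>a\<in>in_arcs G y. h $ a)"
      by (rule sum_pos2[of _ e]) (use fin i assms True in \<open>auto simp: in_arcs_def y_def\<close>)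
    moreover have "(\<Sum>a\<in>out_arcs G y. h $ a) \<le> 0" by (rule sum_nonpos) (rule o)
    ultimately show ?thesis by (simp add: boundary_def)
  next
    case False
    have "0 < (\<Sum>a\<in>out_arcs G y. - h $ a)"
      by (rule sum_pos2[of _ e]) (use fin o assms False in \<open>auto simp: out_arcs_def y_def\<close>)
    moreover have "(\<Sum>a\<in>in_arcs G y. h $ a) \<ge> 0" by (rule sum_nonneg) (rule i)
    ultimately show ?thesis by (simp add: boundary_def sum_negf)
  qed
  with assms(1) y show False by (auto simp: H1_def)
qed

text \<open>By conservation of flow every arc of the support has a successor in the support; iterating a
  choice of successors in the finite support must close up.\<close>

lemma ex_conformal_trail:
  assumes "h \<in> H1 G" "h \<noteq> 0"
  obtains u p where "bidir.awalk u p u" "p \<noteq> []" "distinct p"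
    "\<And>e s. (e, s) \<in> set p \<Longrightarrow> if s then h $ e > 0 else h $ e < 0"
proof -
  define A where "A = {(e, s). e \<in> arcs G \<and> (if s then h $ e > 0 else h $ e < 0)}"
  define f where "f a = (SOME a'. a' \<in> A \<and> tail (bidir G) a' = head (bidir G) a)" for a
  have f: "f a \<in> A \<and> tail (bidir G) (f a) = head (bidir G) a" if "a \<in> A" for a
  proof -
    have "\<exists>a'. a' \<in> A \<and> tail (bidir G) a' = head (bidir G) a"
    proof -
      have "fst a \<in> arcs G" "if snd a then h $ fst a > 0 else h $ fst a < 0"
        using that by (auto simp: A_def)
      from successor_arc[OF assms(1) this] show ?thesis
        unfolding A_def prod.collapse by blast
    qed
    then show ?thesis unfolding f_def by (rule someI_ex)
  qed
  have fin: "finite A" by simp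
  obtain e where "h $ e \<noteq> 0" using assms(2) by (auto simp: vec_eq_iff)
  then have "(e, h $ e > 0) \<in> A" using assms(1) by (auto simp: A_def H1_def)
  then obtain a k where a: "a \<in> A" "k > 0" "(f ^^ k) a = a"
    and dist: "distinct (map (\<lambda>i. (f ^^ i) a) [0..<k])"
    by (rule ex_distinct_funpow_cycle[OF fin, where f = f]) (use f in auto)
  define p where "p = map (\<lambda>i. (f ^^ i) a) [0..<k]"
  have A: "(f ^^ n) a \<in> A" for n using a(1) f by (induction n) auto
  \<comment> \<open>The starting index \<open>m\<close> is general so that the induction can peel
    off the first arc. For m = 0 and n = k the walk closes up, because
    \<open>(f ^^ k) a = a\<close>.\<close>
  have cas: "bidir.cas (tail (bidir G) ((f ^^ m) a)) (map (\<lambda>i. (f ^^ i) a) [m..<m + n])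
      (tail (bidir G) ((f ^^ (m + n)) a))" for m n
  proof (induction n arbitrary: m)
    case (Suc n)
    then show ?case
      using Suc[of "Suc m"] f[OF A[of m]] by (simp add: upt_conv_Cons del: upt_Suc)
  qed simp
  have p_A: "set p \<subseteq> A" using A by (auto simp: p_def)
  then have arcs: "set p \<subseteq> arcs (bidir G)" by (auto simp: A_def)
  have "tail (bidir G) a \<in> verts (bidir G)"
    using a(1) by (intro bidir.tail_in_verts) (auto simp: A_def)
  then have "bidir.awalk (tail (bidir G) a) p (tail (bidir G) a)"
    using cas[of 0 k] a arcs by (simp add: bidir.awalk_def p_def)
  moreover have "if s then h $ e > 0 else h $ e < 0" if "(e, s) \<in> set p" for e s
    using that p_A by (auto simp: A_def)
  ultimately show thesis using that[of _ p] dist a(2) by (auto simp: p_def)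
qed

text \<open>The direction in which \<open>p\<close> traverses an edge is fixed by the sign of
  \<open>h\<close> there. As the entries of \<open>p\<close> are distinct, each edge occurs at most
  once.\<close>

lemma conformal_trail_chain:
  fixes h :: "'e chain"
  assumes "distinct p" "\<And>e s. (e, s) \<in> set p \<Longrightarrow> if s then h $ e > 0 else h $ e < 0"
  shows "path_chain p $ e = (if e \<in> fst ` set p then sgn (h $ e) else 0)"
  using assms
proof (induction p)
  case (Cons a p)
  obtain d s where a: "a = (d, s)" by fastforce
  have IH: "path_chain p $ e = (if e \<in> fst ` set p then sgn (h $ e) else 0)"
    using Cons.prems(1) by (intro Cons.IH Cons.prems(2)) auto
  have sgn: "(if s then 1 else -1) = sgn (h $ d)" using Cons.prems(2)[of d s] by (auto simp: a)
  have "d \<notin> fst ` set p"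
  proof
    assume "d \<in> fst ` set p"
    then obtain t where t: "(d, t) \<in> set p" by auto
    with Cons.prems(1) have "t = (\<not> s)" by (cases s; cases t) (auto simp: a)
    with t show False using Cons.prems(2)[of d s] Cons.prems(2)[of d "\<not> s"] by (auto simp: a split: if_splits)
  qed
  then show ?case using IH sgn by (auto simp: a axis_def)
qed simp

text \<open>Each edge of the trail occurs once, hence with coefficient 1 or -1, and nothing cancels:
  the bound of \<open>l1_path_chain_le\<close> becomes an equality.\<close>

lemma conformal_trail_length:
  fixes h :: "'e chain"
  assumes "distinct p" "\<And>e s. (e, s) \<in> set p \<Longrightarrow> if s then h $ e > 0 else h $ e < 0"
    and "set p \<subseteq> arcs G \<times> UNIV"
  shows "path_length w p = l1 (path_chain p)"
proof -
  have inj: "inj_on fst (set p)"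
  proof (rule inj_onI)
    fix a b assume ab: "a \<in> set p" "b \<in> set p" "fst a = fst b"
    then obtain e s t where "a = (e, s)" "b = (e, t)" by (metis prod.collapse)
    with ab show "a = b"
      using assms(2)[of e s] assms(2)[of e t] by (cases s; cases t) auto
  qed
  have "path_length w p = (\<Sum>a\<in>set p. w (fst a))"
    unfolding path_length_def using assms(1) by (simp add: sum_list_distinct_conv_sum_set split_def)
  also have "\<dots> = (\<Sum>e\<in>fst ` set p. w e)"
    by (simp add: sum.reindex[OF inj])
  also have "\<dots> = (\<Sum>e\<in>arcs G. if e \<in> fst ` set p then w e else 0)"
    using assms(3) by (subst sum.inter_restrict[symmetric]) (auto intro!: sum.cong)
  also have "\<dots> = l1 (path_chain p)"
    unfolding l1_def
  proof (intro sum.cong refl)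
    fix e
    have "h $ e \<noteq> 0" if "e \<in> fst ` set p"
    proof -
      obtain s where "(e, s) \<in> set p" using \<open>e \<in> fst ` set p\<close> by auto
      then show ?thesis using assms(2)[of e s] by (cases s) auto
    qed
    then show "(if e \<in> fst ` set p then w e else 0) = w e * \<bar>path_chain p $ e\<bar>"
      by (simp add: conformal_trail_chain[OF assms(1,2)] sgn_if)
  qed
  finally show ?thesis .
qed

text \<open>Induction on the size of the support. A suitable multiple of the chain of a trail along
  the flow is subtracted; it removes the edge \<open>e0\<close> from the support and brings in no
  new edge.\<close>

lemma H1_subset_span: "H1 G \<subseteq> span (H1_int G)"
proof
  fix h assume "h \<in> H1 G"
  then show "h \<in> span (H1_int G)"
  proof (induction "card {e. h $ e \<noteq> 0}" arbitrary: h rule: less_induct)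
    case less
    show ?case
    proof (cases "h = 0")
      case False
      obtain u p where p: "bidir.awalk u p u" "p \<noteq> []" "distinct p"
        and conf: "\<And>e s. (e, s) \<in> set p \<Longrightarrow> if s then h $ e > 0 else h $ e < 0"
        using ex_conformal_trail[OF less.prems False] by metis
      note z = conformal_trail_chain[OF p(3) conf]
      let ?z = "path_chain p"
      have "finite (fst ` set p)" "fst ` set p \<noteq> {}" using p(2) by auto
      then obtain e0 where e0: "e0 \<in> fst ` set p" "\<And>e. e \<in> fst ` set p \<Longrightarrow> \<bar>h $ e0\<bar> \<le> \<bar>h $ e\<bar>"
        using arg_min_if_finite[of "fst ` set p" "\<lambda>e. \<bar>h $ e\<bar>"] by (metis not_le)
      let ?h = "h - \<bar>h $ e0\<bar> *\<^sub>R ?z"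
      have zint: "?z \<in> H1_int G" by (rule path_chain_H1_int[OF p(1)])
      have hH1: "?h \<in> H1 G"
        using zint H1_int_subset less.prems
        by (intro subspace_diff subspace_scale subspace_H1) auto
      have he0: "h $ e0 \<noteq> 0" using e0(1) conf by (force split: if_splits)
      have "{e. ?h $ e \<noteq> 0} \<subset> {e. h $ e \<noteq> 0}"
      proof
        show "{e. ?h $ e \<noteq> 0} \<subseteq> {e. h $ e \<noteq> 0}" by (auto simp: z)
        show "{e. ?h $ e \<noteq> 0} \<noteq> {e. h $ e \<noteq> 0}"
          using he0 e0(1) by (auto simp: z set_eq_iff abs_mult_sgn intro!: exI[of _ e0])
      qed
      then have "?h \<in> span (H1_int G)"
        by (intro less.hyps hH1 psubset_card_mono) auto
      then have "?h + \<bar>h $ e0\<bar> *\<^sub>R ?z \<in> span (H1_int G)"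
        using zint by (intro span_add span_scale) (auto intro: span_base)
      then show ?thesis by simp
    qed (simp add: span_zero)
  qed
qed

end

section \<open>The length of an integral homology class\<close>

definition reverse_path :: "('e \<times> bool) list \<Rightarrow> ('e \<times> bool) list" where
  "reverse_path p = rev (map (\<lambda>(e, s). (e, \<not> s)) p)"

lemma path_chain_reverse: "path_chain (reverse_path p) = - path_chain p"
  by (induction p) (auto simp: reverse_path_def)

text \<open>The two steps of a backtracking contribute opposite chains. This makes
  \<open>homology_class\<close> well defined.\<close>

lemma homotopy_path_chain:
  assumes "(p, q) \<in> homotopy G x"
  shows "path_chain p = path_chain q"
proof -
  have "(p, q) \<in> (backtracking G x \<union> (backtracking G x)\<inverse>)\<^sup>*"
    using assms by (simp add: homotopy_def)
  then show ?thesis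
    by (induction rule: rtrancl_induct) (auto simp: backtracking_def)
qed

context weighted_digraph
begin

section \<open>Tours through all vertices in a prescribed homology class\<close>

lemma awalk_reverse_path: "bidir.awalk u p v \<Longrightarrow> bidir.awalk v (reverse_path p) u"
proof (induction p arbitrary: u)
  case Nil
  then show ?case by (auto simp: reverse_path_def bidir.awalk_Nil_iff)
next
  case (Cons a p)
  obtain e s where a: "a = (e, s)" by fastforce
  have "bidir.awalk (head (bidir G) a) [(e, \<not> s)] u"
    using Cons.prems by (auto simp: a bidir.awalk_Cons_iff bidir.awalk_Nil_iff)
  moreover have "bidir.awalk v (reverse_path p) (head (bidir G) a)"
    using Cons by (simp add: bidir.awalk_Cons_iff)
  ultimately show ?case
    using bidir.awalk_appendI by (fastforce simp: reverse_path_def a)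
qed

text \<open>Connectedness is reachability in the symmetrized graph, each of whose steps is an arc
  taken forwards or backwards.\<close>

lemma ex_awalk_bidir:
  assumes "Digraph_Component.connected G" "u \<in> verts G" "v \<in> verts G"
  shows "\<exists>p. bidir.awalk u p v"
proof -
  have "(u, v) \<in> (arcs_ends (mk_symmetric G))\<^sup>*"
    using assms by (intro reachable_rtranclI) (auto simp: Digraph_Component.connected_def)
  then show ?thesis
  proof (induction rule: rtrancl_induct)
    case base
    then show ?case using assms by (intro exI[of _ "[]"]) (simp add: bidir.awalk_Nil_iff)
  next
    case (step y z)
    obtain p e s where p: "bidir.awalk u p y" and "(e, s) \<in> arcs (bidir G)"
      "tail (bidir G) (e, s) = y" "head (bidir G) (e, s) = z"
    proof -
      obtain p where "bidir.awalk u p y" using step.IH by blast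
      moreover obtain e where "e \<in> arcs G"
        "tail G e = y \<and> head G e = z \<or> head G e = y \<and> tail G e = z"
        using step.hyps by (auto simp: parcs_mk_symmetric)
      ultimately show thesis
        using that[of p e True] that[of p e False] by auto
    qed
    then have "bidir.awalk y [(e, s)] z"
      using bidir.awalk_last_in_verts[OF p] bidir.head_in_verts[of "(e, s)"]
      by (simp add: bidir.awalk_Cons_iff bidir.awalk_Nil_iff)
    then show ?case using bidir.awalk_appendI[OF p] by blast
  qed
qed

text \<open>Walking to each vertex and back along the same path visits it without changing the
  chain. The tour serves as a skeleton into which closed trails can be spliced at any
  vertex.\<close>

lemma ex_null_tour:
  assumes "Digraph_Component.connected G" "x \<in> verts G"
  shows "\<exists>p. bidir.awalk x p x \<and> verts G \<subseteq> set (bidir.awalk_verts x p) \<and> path_chain p = 0"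
proof -
  have "\<exists>p. bidir.awalk x p x \<and> V \<subseteq> set (bidir.awalk_verts x p) \<and> path_chain p = 0"
    if "finite V" "V \<subseteq> verts G" for V
    using that
  proof (induction V rule: finite_induct)
    case empty
    then show ?case using assms by (intro exI[of _ "[]"]) (simp add: bidir.awalk_Nil_iff)
  next
    case (insert v V)
    then obtain p q where p: "bidir.awalk x p x" "V \<subseteq> set (bidir.awalk_verts x p)" "path_chain p = 0"
      and q: "bidir.awalk x q v"
      using ex_awalk_bidir[OF assms, of v] by auto
    note r = awalk_reverse_path[OF q]
    have qr: "bidir.awalk x (q @ reverse_path q) x" by (rule bidir.awalk_appendI[OF q r])
    have "v \<in> set (bidir.awalk_verts x q)"
      using last_in_set[OF bidir.awalk_verts_non_Nil, where u1 = x and p1 = q] q by simp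
    then show ?case
      using p q r qr
      by (intro exI[of _ "p @ (q @ reverse_path q)"] conjI bidir.awalk_appendI[OF p(1) qr])
        (auto simp: bidir.set_awalk_verts_append[OF p(1) qr] bidir.set_awalk_verts_append[OF q r]
           path_chain_reverse simp del: bidir.awalk_append_iff)
  qed
  from this[of "verts G"] show ?thesis by simp
qed

text \<open>The tour is cut at a visit of \<open>u\<close> and \<open>c\<close> is spliced in. Since
  the result again visits every vertex, insertions can be iterated.\<close>

lemma tour_insert:
  assumes p: "bidir.awalk x p x" "verts G \<subseteq> set (bidir.awalk_verts x p)"
    and c: "bidir.awalk u c u"
  shows "\<exists>p'. bidir.awalk x p' x \<and> verts G \<subseteq> set (bidir.awalk_verts x p') \<and>
    path_chain p' = path_chain p + path_chain c \<and>
    path_length w p' = path_length w p + path_length w c"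
proof -
  have "u \<in> set (bidir.awalk_verts x p)"
    using p(2) bidir.awalk_hd_in_verts[OF c] by auto
  then obtain q r where qr: "p = q @ r" "bidir.awalk x q u" "bidir.awalk u r x"
    using bidir.awalk_decomp[OF p(1)] by blast
  note cr = bidir.awalk_appendI[OF c qr(3)]
  have "verts G \<subseteq> set (bidir.awalk_verts x (q @ c @ r))"
    using p(2) unfolding qr(1) bidir.set_awalk_verts_append[OF qr(2,3)]
      bidir.set_awalk_verts_append[OF qr(2) cr] bidir.set_awalk_verts_append[OF c qr(3)] by blast
  then show ?thesis
    using bidir.awalk_appendI[OF qr(2) cr] by (intro exI[of _ "q @ c @ r"]) (simp add: qr(1))
qed

text \<open>A closed trail along the flow of \<open>h\<close> is peeled off and the tour of the
  remaining class, given by induction, is extended by it. Peeling splits the \<open>l1\<close> norm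
  additively, so only the length of \<open>p0\<close> is added in the end.\<close>

lemma ex_tour_of_class:
  assumes p0: "bidir.awalk x p0 x" "verts G \<subseteq> set (bidir.awalk_verts x p0)" "path_chain p0 = 0"
    and "h \<in> H1_int G"
  shows "\<exists>p. bidir.awalk x p x \<and> verts G \<subseteq> set (bidir.awalk_verts x p) \<and>
    path_chain p = h \<and> path_length w p = l1 h + path_length w p0"
  using assms(4)
proof (induction "\<Sum>e\<in>UNIV. nat \<lfloor>\<bar>h $ e\<bar>\<rfloor>" arbitrary: h rule: less_induct)
  case less
  show ?case
  proof (cases "h = 0")
    case True
    then show ?thesis using p0 by (intro exI[of _ p0]) (simp add: l1_def)
  next
    case False
    have hH1: "h \<in> H1 G" using less.prems H1_int_subset by blast
    obtain u c where c: "bidir.awalk u c u" "c \<noteq> []" "distinct c"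
      and conf: "\<And>e s. (e, s) \<in> set c \<Longrightarrow> if s then h $ e > 0 else h $ e < 0"
      using ex_conformal_trail[OF hH1 False] by metis
    note z = conformal_trail_chain[OF c(3) conf]
    let ?z = "path_chain c"
    have nz: "h $ e \<noteq> 0" if "e \<in> fst ` set c" for e
      using that conf by (force split: if_splits)
    have abs1: "1 \<le> \<bar>h $ e\<bar>" if "h $ e \<noteq> 0" for e
      using less.prems that Ints_nonzero_abs_ge1 by (auto simp: H1_int_def)
    \<comment> \<open>Nonzero integers have modulus at least 1, so subtracting the sign never
      overshoots 0. The total of the moduli therefore decreases.\<close>
    have split: "\<bar>h $ e\<bar> = \<bar>(h - ?z) $ e\<bar> + \<bar>?z $ e\<bar>" for e
      using abs1[of e] by (auto simp: z sgn_if)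
    have le: "nat \<lfloor>\<bar>(h - ?z) $ e\<bar>\<rfloor> \<le> nat \<lfloor>\<bar>h $ e\<bar>\<rfloor>" for e
      using split[of e] by (intro nat_mono floor_mono) simp
    obtain e0 where e0: "e0 \<in> fst ` set c" using c(2) by (cases c) auto
    have "\<bar>h $ e0\<bar> = \<bar>(h - ?z) $ e0\<bar> + 1"
      using split[of e0] e0 nz[OF e0] by (simp add: z sgn_if split: if_splits)
    then have lt: "nat \<lfloor>\<bar>(h - ?z) $ e0\<bar>\<rfloor> < nat \<lfloor>\<bar>h $ e0\<bar>\<rfloor>"
      by simp
    have "(\<Sum>e\<in>UNIV. nat \<lfloor>\<bar>(h - ?z) $ e\<bar>\<rfloor>) < (\<Sum>e\<in>UNIV. nat \<lfloor>\<bar>h $ e\<bar>\<rfloor>)"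
      by (rule sum_strict_mono_ex1) (use le lt in auto)
    moreover have "h - ?z \<in> H1_int G"
      by (rule H1_int_diff[OF less.prems path_chain_H1_int[OF c(1)]])
    ultimately obtain p where p: "bidir.awalk x p x" "verts G \<subseteq> set (bidir.awalk_verts x p)"
      "path_chain p = h - ?z" "path_length w p = l1 (h - ?z) + path_length w p0"
      using less.hyps by blast
    have "path_length w c = l1 ?z"
      using c(1) by (intro conformal_trail_length[OF c(3) conf]) (auto simp: bidir.awalk_def)
    moreover have "l1 h = l1 (h - ?z) + l1 ?z"
      unfolding l1_def split by (simp add: distrib_left sum.distrib)
    ultimately show ?thesis using tour_insert[OF p(1,2) c(1)] p(3,4)
      by (simp add: algebra_simps)
  qed
qed

section \<open>Lengths of homotopy and homology classes\<close>

lemma homology_class_eq: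
  assumes "\<alpha> \<in> pi1 G x" "p \<in> \<alpha>"
  shows "bidir.awalk x p x" "path_chain p = homology_class \<alpha>"
proof -
  obtain q where q: "q \<in> based_cycles G x" "\<alpha> = homotopy G x `` {q}"
    using assms(1) by (auto simp: pi1_def quotient_def)
  have "path_chain ` \<alpha> = {path_chain q}"
  proof -
    have "path_chain ` \<alpha> = (\<lambda>_. path_chain q) ` \<alpha>"
      using homotopy_path_chain[of q _ G x] by (intro image_cong) (auto simp: q(2))
    then show ?thesis using assms(2) by auto
  qed
  then show "path_chain p = homology_class \<alpha>"
    using assms(2) unfolding homology_class_def by (metis image_eqI singletonD the_elem_eq)
  show "bidir.awalk x p x"
    using q assms(2) by (auto simp: homotopy_def based_cycles_def)
qed

lemma pi1_not_empty: "\<alpha> \<in> pi1 G x \<Longrightarrow> \<alpha> \<noteq> {}"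
  by (auto simp: pi1_def quotient_def homotopy_def)

lemma pi1_length_ge:
  assumes "\<alpha> \<in> pi1 G x"
  shows "l1 (homology_class \<alpha>) \<le> pi1_length w \<alpha>"
  unfolding pi1_length_def
proof (rule cINF_greatest)
  show "\<alpha> \<noteq> {}" by (rule pi1_not_empty[OF assms])
  show "l1 (homology_class \<alpha>) \<le> path_length w p" if "p \<in> \<alpha>" for p
    using l1_path_chain_le homology_class_eq[OF assms that] by metis
qed

text \<open>The constant is the length of one fixed null-homologous tour. Its independence of
  \<open>h\<close> is what makes it vanish in the limit defining the stable norm.\<close>

lemma homology_length_bounds:
  assumes "Digraph_Component.connected G" "x \<in> verts G"
  shows "\<exists>C. \<forall>h\<in>H1_int G. l1 h \<le> homology_length G w x h \<and> homology_length G w x h \<le> l1 h + C"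
proof -
  obtain p0 where p0: "bidir.awalk x p0 x" "verts G \<subseteq> set (bidir.awalk_verts x p0)" "path_chain p0 = 0"
    using ex_null_tour[OF assms] by blast
  have "l1 h \<le> homology_length G w x h \<and> homology_length G w x h \<le> l1 h + path_length w p0"
    if h: "h \<in> H1_int G" for h
  proof -
    obtain p where p: "bidir.awalk x p x" "path_chain p = h" "path_length w p = l1 h + path_length w p0"
      using ex_tour_of_class[OF p0 h] by blast
    let ?\<alpha> = "homotopy G x `` {p}"
    have based: "p \<in> based_cycles G x" using p by (simp add: based_cycles_def)
    then have \<alpha>: "?\<alpha> \<in> pi1 G x" "p \<in> ?\<alpha>"
      by (auto simp: pi1_def homotopy_def intro: quotientI)
    have cl: "homology_class ?\<alpha> = h" using homology_class_eq(2)[OF \<alpha>] p by simp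
    let ?A = "{\<alpha> \<in> pi1 G x. homology_class \<alpha> = h}"
    have in_A: "?\<alpha> \<in> ?A" using \<alpha> cl by blast
    have ge: "l1 h \<le> pi1_length w \<alpha>" if "\<alpha> \<in> ?A" for \<alpha>
      using that pi1_length_ge by auto
    have "l1 h \<le> homology_length G w x h"
      unfolding homology_length_def by (rule cINF_greatest) (use in_A ge in auto)
    moreover have "homology_length G w x h \<le> pi1_length w ?\<alpha>"
      unfolding homology_length_def
      \<comment> \<open>A real infimum lies below its members only if the set is bounded below; the
        lower bound just used supplies this.\<close>
      by (rule cINF_lower) (use in_A ge in \<open>auto intro!: bdd_belowI[of _ "l1 h"]\<close>)
    moreover have "pi1_length w ?\<alpha> \<le> path_length w p"
      unfolding pi1_length_def
      by (rule cINF_lower)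
        (use \<alpha> homology_class_eq(1)[OF \<alpha>(1)] path_length_nonneg in \<open>auto intro!: bdd_belowI[of _ 0]\<close>)
    ultimately show ?thesis using p by simp
  qed
  then show ?thesis by blast
qed

end

section \<open>The stable norm and its unit ball\<close>

lemma scalar_product_on_expansion:
  fixes S :: "'a::euclidean_space set"
  assumes S: "subspace S" and g: "scalar_product_on S g"
  shows "\<exists>B. finite B \<and> (\<forall>x\<in>S. g x x = (\<Sum>b\<in>B. \<Sum>c\<in>B. (x \<bullet> b) * (x \<bullet> c) * g c b))"
proof -
  obtain B where B: "B \<subseteq> S" "pairwise orthogonal B" "\<And>x. x \<in> B \<Longrightarrow> norm x = 1"
    "independent B" "span B = S"
    using orthonormal_basis_subspace[OF S] by metis
  have fin: "finite B" using B(4) by (rule independent_imp_finite)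
  have add: "g (x + y) z = g x z + g y z" if "x \<in> S" "y \<in> S" "z \<in> S" for x y z
    using g that by (auto simp: scalar_product_on_def)
  have scale: "g (a *\<^sub>R x) y = a * g x y" if "x \<in> S" "y \<in> S" for a x y
    using g that by (auto simp: scalar_product_on_def)
  have sym: "g x y = g y x" if "x \<in> S" "y \<in> S" for x y
    using g that by (auto simp: scalar_product_on_def)
  have expand: "g x y = (\<Sum>b\<in>B. (x \<bullet> b) * g b y)" if xy: "x \<in> S" "y \<in> S" for x y
  proof -
    \<comment> \<open>The laws of \<open>g\<close> are available on \<open>S\<close> only, so the
      induction over subsets of \<open>B\<close> keeps all partial sums in \<open>S\<close>.\<close>
    have "g (\<Sum>b\<in>A. (x \<bullet> b) *\<^sub>R b) y = (\<Sum>b\<in>A. (x \<bullet> b) * g b y)" if "finite A" "A \<subseteq> B" for A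
      using that
    proof (induction A rule: finite_induct)
      case empty
      then show ?case using scale[of 0 y 0] subspace_0[OF S] xy by simp
    next
      case (insert b A)
      have "(\<Sum>b\<in>A. (x \<bullet> b) *\<^sub>R b) \<in> S" "b \<in> S"
        using insert.prems B(1) S by (auto intro!: subspace_sum subspace_scale)
      then show ?case
        using insert xy S by (simp add: add scale subspace_scale)
    qed
    moreover have "(\<Sum>b\<in>B. (x \<bullet> b) *\<^sub>R b) = x"
      using orthonormal_basis_expand[OF B(2,3) _ fin] B(5) xy by simp
    ultimately show ?thesis using fin by force
  qed
  have "g x x = (\<Sum>b\<in>B. \<Sum>c\<in>B. (x \<bullet> b) * (x \<bullet> c) * g c b)" if x: "x \<in> S" for x
  proof -
    have "g x x = (\<Sum>b\<in>B. (x \<bullet> b) * g x b)"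
      unfolding expand[OF x x] using B(1) x sym by (intro sum.cong) auto
    also have "\<dots> = (\<Sum>b\<in>B. (x \<bullet> b) * (\<Sum>c\<in>B. (x \<bullet> c) * g c b))"
      using B(1) x by (intro sum.cong) (auto simp: expand[of x])
    finally show ?thesis by (simp add: sum_distrib_left mult.assoc)
  qed
  with fin show ?thesis by blast
qed

text \<open>The form is continuous and positive on the compact unit sphere of \<open>S\<close>, so
  it attains a positive minimum and a maximum there; homogeneity extends the bounds to
  \<open>S\<close>. If \<open>S\<close> is trivial the sphere is empty and any constants do.\<close>

lemma scalar_product_on_norm_equiv:
  fixes S :: "'a::euclidean_space set"
  assumes S: "subspace S" and g: "scalar_product_on S g"
  shows "continuous_on S (\<lambda>x. g x x)"
    and "\<exists>c>0. \<exists>C. \<forall>x\<in>S. c * norm x \<le> sqrt (g x x) \<and> sqrt (g x x) \<le> C * norm x"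
proof -
  obtain B where "finite B" and B: "\<And>x. x \<in> S \<Longrightarrow> g x x = (\<Sum>b\<in>B. \<Sum>c\<in>B. (x \<bullet> b) * (x \<bullet> c) * g c b)"
    using scalar_product_on_expansion[OF assms] by blast
  show cont: "continuous_on S (\<lambda>x. g x x)"
    by (subst continuous_on_cong[OF refl B]) (auto intro!: continuous_intros)
  let ?K = "sphere 0 1 \<inter> S"
  have K: "compact ?K"
    by (intro compact_Int_closed compact_sphere closed_subspace S)
  have homog: "g x x = (norm x)\<^sup>2 * g (x /\<^sub>R norm x) (x /\<^sub>R norm x)" if "x \<in> S" "x \<noteq> 0" for x
  proof -
    let ?y = "x /\<^sub>R norm x"
    have y: "?y \<in> S" "norm x *\<^sub>R ?y = x" "norm x *\<^sub>R ?y \<in> S"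
      using that subspace_scale[OF S that(1)] by auto
    have "g (norm x *\<^sub>R ?y) (norm x *\<^sub>R ?y) = (norm x)\<^sup>2 * g ?y ?y"
      using g y(1,3) unfolding scalar_product_on_def power2_eq_square by (metis mult.assoc)
    then show ?thesis unfolding y(2) .
  qed
  have pos: "g x x > 0" if "x \<in> S" "x \<noteq> 0" for x
    using g that by (auto simp: scalar_product_on_def)
  have zero: "g 0 0 = 0" by (simp add: B subspace_0[OF S])
  show "\<exists>c>0. \<exists>C. \<forall>x\<in>S. c * norm x \<le> sqrt (g x x) \<and> sqrt (g x x) \<le> C * norm x"
  proof (cases "?K = {}")
    case True
    have "x = 0" if "x \<in> S" for x
    proof (rule ccontr)
      assume "x \<noteq> 0"
      then have "x /\<^sub>R norm x \<in> ?K" using subspace_scale[OF S that] by simp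
      with True show False by blast
    qed
    then have "1 * norm x \<le> sqrt (g x x) \<and> sqrt (g x x) \<le> 1 * norm x" if "x \<in> S" for x
      using zero that by force
    then show ?thesis using zero_less_one by blast
  next
    case False
    note contK = continuous_on_subset[OF cont, of ?K]
    obtain a where a: "a \<in> ?K" "\<And>y. y \<in> ?K \<Longrightarrow> g a a \<le> g y y"
      using continuous_attains_inf[OF K False contK] by blast
    obtain b where b: "b \<in> ?K" "\<And>y. y \<in> ?K \<Longrightarrow> g y y \<le> g b b"
      using continuous_attains_sup[OF K False contK] by blast
    have "sqrt (g a a) * norm x \<le> sqrt (g x x) \<and> sqrt (g x x) \<le> sqrt (g b b) * norm x"
      if "x \<in> S" for x
    proof (cases "x = 0")
      case False
      then have "x /\<^sub>R norm x \<in> ?K" using subspace_scale[OF S that] by simp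
      from a(2)[OF this] b(2)[OF this] show ?thesis
        unfolding homog[OF that False] by (auto simp: real_sqrt_mult mult.commute intro!: mult_left_mono)
    qed (simp add: zero)
    moreover have "sqrt (g a a) > 0" using a(1) pos[of a] by force
    ultimately show ?thesis by blast
  qed
qed

lemma closed_H1_int: "closed (H1_int G)" for G :: "('v, 'e::finite) pre_digraph"
proof -
  have "H1_int G = H1 G \<inter> (\<Inter>e. (\<lambda>c. c $ e) -` \<int>)"
    by (auto simp: H1_int_def)
  then show ?thesis
    by (auto intro!: closed_Int[OF closed_subspace[OF subspace_H1]] closed_INT closed_vimage continuous_intros)
qed

text \<open>\<open>arg_min_on\<close> is a choice, so a minimizer has to be exhibited. Lattice
  points no farther from \<open>v\<close> than the lattice point 0 lie in a closed ball by the lower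
  norm bound, and the lattice is closed, so the search is over a compact set.\<close>

lemma nearest_H1_int:
  assumes g: "scalar_product_on (H1 G) g" and v: "v \<in> H1 G"
  shows "nearest_H1_int G g v \<in> H1_int G"
    and "z \<in> H1_int G \<Longrightarrow>
      sqrt (g (nearest_H1_int G g v - v) (nearest_H1_int G g v - v)) \<le> sqrt (g (z - v) (z - v))"
proof -
  let ?f = "\<lambda>z. sqrt (g (z - v) (z - v))"
  obtain c where c: "c > 0" "\<And>x. x \<in> H1 G \<Longrightarrow> c * norm x \<le> sqrt (g x x)"
    using scalar_product_on_norm_equiv(2)[OF subspace_H1 g] by blast
  let ?K = "H1_int G \<inter> cball v (?f 0 / c)"
  have diff: "z - v \<in> H1 G" if "z \<in> H1_int G" for z
    using that v H1_int_subset by (intro subspace_diff subspace_H1) auto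
  have in_K: "z \<in> ?K" if "z \<in> H1_int G" "?f z \<le> ?f 0" for z
  proof -
    have "c * norm (z - v) \<le> ?f 0" using c(2)[OF diff[OF that(1)]] that(2) by (rule order_trans)
    then show ?thesis using that(1) c(1) by (simp add: dist_norm norm_minus_commute field_simps)
  qed
  have K: "compact ?K" by (intro closed_Int_compact closed_H1_int compact_cball)
  have K0: "?K \<noteq> {}" using in_K[OF zero_H1_int] by auto
  have K_cont: "continuous_on ?K ?f"
    using diff
    by (intro continuous_on_real_sqrt continuous_on_compose2[OF scalar_product_on_norm_equiv(1)[OF subspace_H1 g]]
        continuous_intros) auto
  obtain a where a: "a \<in> ?K" "\<And>y. y \<in> ?K \<Longrightarrow> ?f a \<le> ?f y"
    using continuous_attains_inf[OF K K0 K_cont] by blast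
  have "?f a \<le> ?f 0" using a(2)[OF in_K[OF zero_H1_int]] by simp
  then have "?f a \<le> ?f z" if "z \<in> H1_int G" for z
    using a(2) in_K[OF that] by (cases "?f z \<le> ?f 0") auto
  then have "is_arg_min ?f (\<lambda>z. z \<in> H1_int G) a"
    using a(1) by (auto simp: is_arg_min_linorder)
  then have *: "is_arg_min ?f (\<lambda>z. z \<in> H1_int G) (nearest_H1_int G g v)"
    unfolding nearest_H1_int_def arg_min_on_def arg_min_def by (rule someI)
  then show "nearest_H1_int G g v \<in> H1_int G"
    and "z \<in> H1_int G \<Longrightarrow> ?f (nearest_H1_int G g v) \<le> ?f z"
    by (auto simp: is_arg_min_linorder)
qed

section \<open>The weighted scalar product, the stable norm and the Haar measure\<close>

lemma chain_inner_commute: "chain_inner G w c d = chain_inner G w d c"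
  by (simp add: chain_inner_def mult_ac)

lemma chain_inner_sum_left:
  "chain_inner G w (\<Sum>i\<in>I. x i *\<^sub>R B i) d = (\<Sum>i\<in>I. x i * chain_inner G w (B i) d)"
  unfolding chain_inner_def sum_component sum_distrib_left sum_distrib_right
  by (subst sum.swap) (simp add: mult_ac)

lemma chain_inner_orthonormal:
  assumes "orthonormal_basis_H1 G w B"
  shows "chain_inner G w (\<Sum>i<betti G. x i *\<^sub>R B i) (\<Sum>i<betti G. x i *\<^sub>R B i) = (\<Sum>i<betti G. (x i)\<^sup>2)"
proof -
  let ?c = "\<Sum>i<betti G. x i *\<^sub>R B i"
  have "chain_inner G w (B i) ?c = x i" if "i < betti G" for i
  proof -
    have "chain_inner G w (B i) ?c = (\<Sum>j<betti G. x j * chain_inner G w (B j) (B i))"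
      by (subst chain_inner_commute) (rule chain_inner_sum_left)
    also have "\<dots> = (\<Sum>j<betti G. if j = i then x j else 0)"
      using assms that by (intro sum.cong) (auto simp: orthonormal_basis_H1_def)
    finally show ?thesis using that by simp
  qed
  then show ?thesis by (subst chain_inner_sum_left) (simp add: power2_eq_square)
qed

context weighted_digraph
begin

lemma continuous_l1: "continuous_on S l1"
  unfolding l1_def by (intro continuous_intros)

text \<open>Cauchy-Schwarz, with each weight split into two square roots: one factor gives the
  volume, the other the weighted norm.\<close>

lemma l1_le_chain_inner: "l1 c \<le> sqrt (Vol G w) * sqrt (chain_inner G w c c)"
proof -
  have "l1 c = (\<Sum>e\<in>arcs G. \<bar>sqrt (w e)\<bar> * \<bar>sqrt (w e) * c $ e\<bar>)"
    unfolding l1_def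
    by (intro sum.cong) (auto simp: abs_mult mult.assoc[symmetric] less_imp_le[OF weight_pos])
  also have "\<dots> \<le> L2_set (\<lambda>e. sqrt (w e)) (arcs G) * L2_set (\<lambda>e. sqrt (w e) * c $ e) (arcs G)"
    by (rule L2_set_mult_ineq)
  also have "\<dots> = sqrt (Vol G w) * sqrt (chain_inner G w c c)"
    unfolding L2_set_def Vol_def chain_inner_def
    by (intro arg_cong2[where f = "(*)"] arg_cong[where f = sqrt] sum.cong)
      (auto simp: power_mult_distrib less_imp_le[OF weight_pos] power2_eq_square mult.assoc)
  finally show ?thesis .
qed

text \<open>Write \<open>u\<close> as a combination of finitely many integral cycles and round the
  coefficients of its multiples down. Each rounding error is at most 1, which bounds the distance
  independently of \<open>n\<close>.\<close>

lemma ex_H1_int_near_multiples: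
  assumes "u \<in> H1 G"
  shows "\<exists>D. \<forall>n::nat. \<exists>z\<in>H1_int G. norm (z - real n *\<^sub>R u) \<le> D"
proof -
  obtain t r where t: "finite t" "t \<subseteq> H1_int G" "u = (\<Sum>a\<in>t. r a *\<^sub>R a)"
    using assms H1_subset_span unfolding span_explicit by blast
  have "\<exists>z\<in>H1_int G. norm (z - real n *\<^sub>R u) \<le> (\<Sum>a\<in>t. norm a)" for n
  proof
    let ?z = "\<Sum>a\<in>t. of_int \<lfloor>n * r a\<rfloor> *\<^sub>R a"
    show "?z \<in> H1_int G" using t(2) by (auto intro!: H1_int_sum H1_int_scale)
    have "?z - real n *\<^sub>R u = (\<Sum>a\<in>t. (of_int \<lfloor>n * r a\<rfloor> - n * r a) *\<^sub>R a)"
      by (simp add: t(3) scaleR_sum_right sum_subtractf scaleR_diff_left)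
    also have "norm \<dots> \<le> (\<Sum>a\<in>t. norm a)"
    proof (rule sum_norm_le)
      fix a
      have "\<bar>of_int \<lfloor>n * r a\<rfloor> - n * r a\<bar> \<le> 1" by linarith
      then show "norm ((of_int \<lfloor>n * r a\<rfloor> - n * r a) *\<^sub>R a) \<le> norm a"
        by (simp add: mult_left_le_one_le)
    qed
    finally show "norm (?z - real n *\<^sub>R u) \<le> (\<Sum>a\<in>t. norm a)" .
  qed
  then show ?thesis by blast
qed

text \<open>The nearest lattice point is within bounded \<open>l1\<close> distance of n u, and its
  homology length is within bounded distance of its \<open>l1\<close> norm. Division by
  \<open>n\<close> removes both errors.\<close>

lemma stable_norm_eq_l1:
  assumes conn: "Digraph_Component.connected G" and x: "x \<in> verts G"
    and g: "scalar_product_on (H1 G) g" and u: "u \<in> H1 G"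
  shows "stable_norm G w x g u = l1 u"
proof -
  obtain C where C: "\<And>h. h \<in> H1_int G \<Longrightarrow> l1 h \<le> homology_length G w x h"
    "\<And>h. h \<in> H1_int G \<Longrightarrow> homology_length G w x h \<le> l1 h + C"
    using homology_length_bounds[OF conn x] by blast
  obtain k K where k: "k > 0" "\<And>x. x \<in> H1 G \<Longrightarrow> k * norm x \<le> sqrt (g x x)"
    "\<And>x. x \<in> H1 G \<Longrightarrow> sqrt (g x x) \<le> K * norm x"
    using scalar_product_on_norm_equiv(2)[OF subspace_H1 g] by blast
  obtain D where D: "\<And>n::nat. \<exists>z\<in>H1_int G. norm (z - real n *\<^sub>R u) \<le> D"
    using ex_H1_int_near_multiples[OF u] by blast
  define N where "N n = nearest_H1_int G g (real n *\<^sub>R u)" for n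
  have nu: "real n *\<^sub>R u \<in> H1 G" for n by (intro subspace_scale subspace_H1 u)
  have N: "N n \<in> H1_int G" for n unfolding N_def by (rule nearest_H1_int(1)[OF g nu])
  have diff: "z - real n *\<^sub>R u \<in> H1 G" if "z \<in> H1_int G" for z n
    using that nu H1_int_subset by (intro subspace_diff subspace_H1) auto
  have Vol0: "Vol G w \<ge> 0"
    unfolding Vol_def by (intro sum_nonneg less_imp_le[OF weight_pos])
  \<comment> \<open>Some lattice point has norm distance at most \<open>D\<close>, hence
    \<open>g\<close>-distance at most \<bar>K\<bar> D; the nearest one is no farther, and returning
    to the norm costs a factor 1 / k. The volume converts this into an \<open>l1\<close> bound. The
    modulus is taken since \<open>K\<close> may be negative when \<open>H1 G\<close> is
    trivial.\<close>
  define M where "M = Vol G w * (\<bar>K\<bar> * D / k)"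
  have near: "l1 (N n - real n *\<^sub>R u) \<le> M" for n
  proof -
    obtain z where z: "z \<in> H1_int G" "norm (z - real n *\<^sub>R u) \<le> D" using D by blast
    have "k * norm (N n - real n *\<^sub>R u) \<le> sqrt (g (z - real n *\<^sub>R u) (z - real n *\<^sub>R u))"
      using k(2)[OF diff[OF N]] nearest_H1_int(2)[OF g nu z(1)] unfolding N_def by (rule order_trans)
    also have "\<dots> \<le> \<bar>K\<bar> * norm (z - real n *\<^sub>R u)"
      using k(3)[OF diff[OF z(1)]] by (rule order_trans) (auto intro: mult_right_mono)
    also have "\<dots> \<le> \<bar>K\<bar> * D" using z(2) by (intro mult_left_mono) auto
    finally have "norm (N n - real n *\<^sub>R u) \<le> \<bar>K\<bar> * D / k"
      using k(1) by (simp add: field_simps)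
    then show ?thesis
      unfolding M_def using l1_le_norm Vol0 by (meson mult_left_mono order_trans)
  qed
  have bound: "\<bar>1 / real n * homology_length G w x (N n) - l1 u\<bar> \<le> (M + C) / real n" if "n > 0" for n
  proof -
    have "\<bar>homology_length G w x (N n) - l1 (real n *\<^sub>R u)\<bar> \<le> M + C"
      using C[OF N[of n]] l1_diff_le[of "N n" "real n *\<^sub>R u"] near[of n] by linarith
    then have "\<bar>homology_length G w x (N n) - real n * l1 u\<bar> / real n \<le> (M + C) / real n"
      by (intro divide_right_mono) (auto simp: l1_scaleR)
    moreover have "1 / real n * homology_length G w x (N n) - l1 u
        = (homology_length G w x (N n) - real n * l1 u) / real n"
      using that by (simp add: field_simps)
    ultimately show ?thesis by (simp add: abs_divide)
  qed
  have "(\<lambda>n. (M + C) / real n) \<longlonglongrightarrow> 0"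
    by (rule lim_const_over_n)
  then have "(\<lambda>n. 1 / real n * homology_length G w x (N n) - l1 u) \<longlonglongrightarrow> 0"
    by (rule Lim_null_comparison[rotated])
      (use bound in \<open>auto simp: eventually_sequentially intro!: exI[of _ 1]\<close>)
  then have "(\<lambda>n. 1 / real n * homology_length G w x (N n)) \<longlonglongrightarrow> l1 u"
    by (rule LIM_zero_cancel)
  then show ?thesis
    unfolding stable_norm_def N_def by (rule limI)
qed

text \<open>Justifies the choice made in \<open>haar_H1\<close>. A standard orthonormal basis of the
  rescaled space is pulled back; the scale factor 1 off the graph keeps the rescaling invertible on
  all chains.\<close>

lemma ex_orthonormal_basis_H1: "\<exists>B. orthonormal_basis_H1 G w B"
proof -
  \<comment> \<open>The rescaling \<open>T\<close> turns the weighted scalar product into the standard one.\<close>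
  define k where "k e = (if e \<in> arcs G then sqrt (w e) else 1)" for e
  have k: "k e > 0" for e by (simp add: k_def weight_pos)
  have w: "w e = k e * k e" if "e \<in> arcs G" for e
    using that less_imp_le[OF weight_pos] by (simp add: k_def)
  define T where "T c = (\<chi> e. k e * c $ e)" for c :: "'e chain"
  define T' where "T' c = (\<chi> e. c $ e / k e)" for c :: "'e chain"
  have T'T: "T' (T c) = c" for c
    using k by (simp add: T_def T'_def vec_eq_iff less_imp_neq[symmetric])
  have lin: "linear T" "linear T'"
    by (auto intro!: linearI simp: T_def T'_def vec_eq_iff algebra_simps add_divide_distrib)
  have inj: "inj_on T (H1 G)"
    by (rule inj_on_inverseI[of _ T']) (simp add: T'T)
  have sub: "subspace (T ` H1 G)" by (rule linear_subspace_image[OF lin(1) subspace_H1])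
  obtain A where A: "A \<subseteq> T ` H1 G" "pairwise orthogonal A" "\<And>x. x \<in> A \<Longrightarrow> norm x = 1"
    "independent A" "card A = dim (T ` H1 G)" "span A = T ` H1 G"
    using orthonormal_basis_subspace[OF sub] by metis
  have "dim (T ` H1 G) = betti G"
    unfolding betti_def using inj subspace_H1[of G]
    by (intro dim_image_eq lin) (simp add: span_eq_iff[THEN iffD2])
  then obtain b where b: "bij_betw b {..<betti G} A"
    using ex_bij_betw_nat_finite[OF independent_imp_finite[OF A(4)]] A(5)
    by (auto simp: atLeast0LessThan)
  have inner: "chain_inner G w (T' x) (T' y) = x \<bullet> y" if "x \<in> T ` H1 G" for x y
  proof -
    have "x $ e = 0" if "e \<notin> arcs G" for e
      using \<open>x \<in> T ` H1 G\<close> that by (auto simp: T_def H1_def)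
    then have "x \<bullet> y = (\<Sum>e\<in>arcs G. x $ e * y $ e)"
      unfolding inner_vec_def inner_real_def by (intro sum.mono_neutral_right) auto
    also have "\<dots> = chain_inner G w (T' x) (T' y)"
      unfolding chain_inner_def
      by (intro sum.cong) (use k in \<open>auto simp: T'_def w less_imp_neq[symmetric]\<close>)
    finally show ?thesis ..
  qed
  have "(\<lambda>i. T' (b i)) ` {..<betti G} = T' ` A"
    using bij_betw_imp_surj_on[OF b] by (auto simp: image_image[symmetric])
  then have "span ((\<lambda>i. T' (b i)) ` {..<betti G}) = H1 G"
    by (simp add: linear_span_image[OF lin(2)] A(6) image_image T'T)
  moreover have "chain_inner G w (T' (b i)) (T' (b j)) = (if i = j then 1 else 0)"
    if "i < betti G" "j < betti G" for i j
  proof -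
    have bA: "b i \<in> A" "b j \<in> A" using b that by (auto dest: bij_betwE)
    have "b i \<noteq> b j" if "i \<noteq> j"
      using b \<open>i < betti G\<close> \<open>j < betti G\<close> that by (auto simp: bij_betw_def inj_on_def)
    then have "b i \<bullet> b j = (if i = j then 1 else 0)"
      using bA A(2,3) by (auto simp: pairwise_def orthogonal_def dot_square_norm)
    then show ?thesis using inner[of "b i" "b j"] A(1) bA by auto
  qed
  ultimately show ?thesis
    unfolding orthonormal_basis_H1_def by (intro exI[of _ "\<lambda>i. T' (b i)"]) auto
qed

text \<open>In orthonormal coordinates the \<open>l1\<close> ball contains the Euclidean ball of
  radius \<open>r\<close>, whose volume is known.\<close>

lemma emeasure_haar_H1_ge:
  assumes "r > 0" "sqrt (Vol G w) * r \<le> 1"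
  shows "ennreal (unit_ball_vol (betti G) * r ^ betti G) \<le> emeasure (haar_H1 G w) {u \<in> H1 G. l1 u \<le> 1}"
proof -
  define B where "B = (SOME B. orthonormal_basis_H1 G w B)"
  have B: "orthonormal_basis_H1 G w B"
    unfolding B_def by (rule someI_ex[OF ex_orthonormal_basis_H1])
  let ?b = "betti G"
  let ?P = "\<Pi>\<^sub>M i\<in>{..<?b}. (lborel :: real measure)"
  let ?f = "\<lambda>x. \<Sum>i<?b. x i *\<^sub>R B i"
  let ?L = "{u \<in> H1 G. l1 u \<le> 1}"
  have in_H1: "?f x \<in> H1 G" for x
    using B span_base[of _ "B ` {..<?b}"]
    by (auto simp: orthonormal_basis_H1_def intro!: subspace_sum subspace_scale subspace_H1)
  have "?f \<in> borel_measurable ?P"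
    by measurable
  then have meas: "?f \<in> measurable ?P (restrict_space borel (H1 G))"
    using in_H1 by (intro measurable_restrict_space2) auto
  have "closed (H1 G \<inter> {u. l1 u \<le> 1})"
    by (intro closed_Int closed_subspace subspace_H1 closed_Collect_le continuous_l1 continuous_on_const)
  then have "H1 G \<inter> {u. l1 u \<le> 1} \<in> sets borel" by (rule borel_closed)
  moreover have "?L = H1 G \<inter> {u. l1 u \<le> 1}" by auto
  ultimately have "?L \<in> sets borel" by simp
  then have L: "?L \<in> sets (restrict_space borel (H1 G))"
    by (subst sets_restrict_space_iff) (auto intro: borel_closed closed_subspace subspace_H1)
  have "ennreal (unit_ball_vol (real (card {..<?b})) * r ^ card {..<?b})
      = emeasure ?P ({x. sqrt (\<Sum>i<?b. (x i)\<^sup>2) \<le> r} \<inter> space ?P)"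
    by (rule emeasure_cball_aux[symmetric]) (use assms in auto)
  also have "\<dots> \<le> emeasure ?P (?f -` ?L \<inter> space ?P)"
  proof (rule emeasure_mono)
    have "l1 (?f x) \<le> 1" if "sqrt (\<Sum>i<?b. (x i)\<^sup>2) \<le> r" for x
    proof -
      have "l1 (?f x) \<le> sqrt (Vol G w) * sqrt (\<Sum>i<?b. (x i)\<^sup>2)"
        using l1_le_chain_inner[of "?f x"] unfolding chain_inner_orthonormal[OF B] .
      also have "\<dots> \<le> sqrt (Vol G w) * r"
        using that by (intro mult_left_mono) (auto simp: Vol_def intro!: sum_nonneg less_imp_le[OF weight_pos])
      finally show ?thesis using assms(2) by simp
    qed
    then show "{x. sqrt (\<Sum>i<?b. (x i)\<^sup>2) \<le> r} \<inter> space ?P \<subseteq> ?f -` ?L \<inter> space ?P"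
      using in_H1 by auto
    show "?f -` ?L \<inter> space ?P \<in> sets ?P" by (rule measurable_sets[OF meas L])
  qed
  also have "\<dots> = emeasure (haar_H1 G w) ?L"
    unfolding haar_H1_def Let_def B_def[symmetric] by (rule emeasure_distr[OF meas L, symmetric])
  finally show ?thesis by simp
qed

text \<open>Positive weights leave no edges. This covers the case in which the radius
  \<open>1 / sqrt (Vol G w)\<close> is meaningless.\<close>

lemma Vol_zero_imp_betti_zero:
  assumes "Vol G w = 0"
  shows "betti G = 0"
proof -
  have "arcs G = {}"
  proof (rule ccontr)
    assume "arcs G \<noteq> {}"
    then have "Vol G w > 0" unfolding Vol_def by (intro sum_pos weight_pos) auto
    with assms show False by simp
  qed
  then have "H1 G \<subseteq> {0}" by (auto simp: H1_def vec_eq_iff)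
  then show ?thesis by (simp add: betti_def dim_eq_0)
qed

end

theorem theorem3:
  fixes G :: "('v, 'e::finite) pre_digraph" and w :: "'e \<Rightarrow> real"
    and x0 :: 'v and g :: "'e chain \<Rightarrow> 'e chain \<Rightarrow> real"
  assumes "fin_digraph G"
    and "Digraph_Component.connected G"
    and "\<And>e. e \<in> arcs G \<Longrightarrow> w e > 0"
    and "x0 \<in> verts G"
    and "scalar_product_on (H1 G) g"
  shows "emeasure (haar_H1 G w) (stable_ball G w x0 g) * ennreal (sqrt (Vol G w) ^ betti G)
           \<ge> ennreal (unit_ball_vol (real (betti G)))"
proof -
  interpret weighted_digraph G w
    by (intro weighted_digraph.intro weighted_digraph_axioms.intro assms(1,3))
  have ball: "stable_ball G w x0 g = {u \<in> H1 G. l1 u \<le> 1}"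
    unfolding stable_ball_def using stable_norm_eq_l1[OF assms(2,4,5)] by auto
  \<comment> \<open>If the volume vanishes there are no edges, and any radius will do.\<close>
  define r where "r = (if Vol G w = 0 then 1 else 1 / sqrt (Vol G w))"
  have Vol0: "Vol G w \<ge> 0"
    unfolding Vol_def by (intro sum_nonneg less_imp_le[OF weight_pos])
  \<comment> \<open>For volume 0 the Betti number is 0 as well, and the last identity holds because
    \<open>0 ^ 0 = 1\<close>.\<close>
  have r: "r > 0" "sqrt (Vol G w) * r \<le> 1" "r ^ betti G * sqrt (Vol G w) ^ betti G = 1"
    using Vol0 Vol_zero_imp_betti_zero by (auto simp: r_def power_divide)
  have "ennreal (unit_ball_vol (betti G))
      = ennreal (unit_ball_vol (betti G) * (r ^ betti G * sqrt (Vol G w) ^ betti G))"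
    by (simp only: r(3) mult_1_right)
  also have "\<dots> = ennreal (unit_ball_vol (betti G) * r ^ betti G) * ennreal (sqrt (Vol G w) ^ betti G)"
    using r(1) Vol0 by (simp add: ennreal_mult mult.assoc)
  also have "\<dots> \<le> emeasure (haar_H1 G w) (stable_ball G w x0 g) * ennreal (sqrt (Vol G w) ^ betti G)"
    unfolding ball by (intro mult_right_mono emeasure_haar_H1_ge r) simp
  finally show ?thesis .
qed

end
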